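(* Let $\mathcal{S}\subset\mathbb{R}^d$. Let $X=\{X(s), s\in\mathcal{S}\}$ be a simple max-stable process with pairwise extremal coefficient function $\theta_X(h)$, and let $Y=\{Y(s), s\in\mathcal{S}\}$ be an inverted max-stable process with coefficient of tail dependence function $\eta(h)=1/\theta_Y(h)$, where $\theta_Y$ is the pairwise extremal coefficient function of the simple max-stable process from which $Y$ is built. Assume that $X$ and $Y$ are independent, stationary and isotropic. Let $a\in[0,1]$ and $Z(s)=\max\{aX(s),(1-a)Y(s)\}$, $s\in\mathcal{S}$, and let $F$ denote the common marginal distribution function of $Z$. Then for every $\lambda>0$ the $F^\lambda$-madogram of $Z$, $\nu_{F^\lambda}(h)=\frac12\mathbb{E}\left[\left|F^\lambda\{Z(s)\}-F^\lambda\{Z(s+h)\}\right|\right]$, is given by $$\nu_{F^\lambda}(h)=\frac{\lambda}{1+\lambda}-\frac{2\lambda}{a(\theta_X(h)-1)+1+\lambda}+\frac{\lambda}{a\theta_X(h)+\lambda}-\frac{\lambda\,\theta_Y(h)}{(1-a)\theta_Y(h)+a\theta_X(h)+\lambda}\,\beta\left(\frac{a\theta_X(h)+\lambda}{1-a},\theta_Y(h)\right),$$ where $\beta(\cdot,\cdot)$ is the beta function, and where for $a=1$ the last term (containing $\beta$) is understood as its limit as $a\to1^-$, namely $0$.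
   Context: A simple max-stable process is a max-stable process with unit Fréchet margins, $\mathbb{P}(X(s)\le z)=e^{-1/z}$ for $z>0$. Its bivariate distributions are $\mathbb{P}(X(s)\le x_1,X(s+h)\le x_2)=\exp\{-V_h(x_1,x_2)\}$, where the exponent measure $V_h$ is homogeneous of order $-1$; the pairwise extremal coefficient is $\theta_X(h)=V_h(1,1)\in[1,2]$. An inverted max-stable process is a process of the form $Y(s)=-1/\log\{1-\exp[-Y'(s)^{-1}]\}$, where $Y'$ is a simple max-stable process; $\theta_Y(h)$ denotes the pairwise extremal coefficient of $Y'$. Such a $Y$ has unit Fréchet margins, and its coefficient of tail dependence $\eta(h)$, defined by $\mathbb{P}(Y(s)>x,Y(s+h)>x)\sim x^{-1/\eta(h)}\mathcal{L}_h(x)$ as $x\to\infty$ with $\mathcal{L}_h$ slowly varying at infinity, is $\eta(h)=1/\theta_Y(h)$. $F^\lambda\{x\}$ means $(F(x))^\lambda$. *)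

theory Defs
  imports "HOL-Probability.Probability" "HOL-Library.Landau_Symbols"
begin

text \<open>
  A process indexed by a set \<open>S\<close> of sites is a function \<open>X\<close> with \<open>X s \<omega>\<close> the value at site
  \<open>s\<close>; only the values at sites in \<open>S\<close> matter.  Its law lives on the product
  sigma-algebra, so equality of laws is equality of all finite-dimensional distributions.
\<close>

definition process_law ::
    "'w measure \<Rightarrow> 'a set \<Rightarrow> ('a \<Rightarrow> 'w \<Rightarrow> real) \<Rightarrow> ('a \<Rightarrow> real) measure" where
  "process_law M S X = distr M (PiM S (\<lambda>_. borel)) (\<lambda>\<omega>. \<lambda>s\<in>S. X s \<omega>)"

definition independent_processes ::
    "'w measure \<Rightarrow> 'a set \<Rightarrow> ('a \<Rightarrow> 'w \<Rightarrow> real) \<Rightarrow> ('a \<Rightarrow> 'w \<Rightarrow> real) \<Rightarrow> bool" where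
  "independent_processes M S X Y \<longleftrightarrow>
     prob_space.indep_var M
       (PiM S (\<lambda>_. borel)) (\<lambda>\<omega>. \<lambda>s\<in>S. X s \<omega>)
       (PiM S (\<lambda>_. borel)) (\<lambda>\<omega>. \<lambda>s\<in>S. Y s \<omega>)"

definition stationary ::
    "'w measure \<Rightarrow> 'a::euclidean_space set \<Rightarrow> ('a \<Rightarrow> 'w \<Rightarrow> real) \<Rightarrow> bool" where
  "stationary M S X \<longleftrightarrow>
     (\<forall>J h. finite J \<longrightarrow> J \<subseteq> S \<longrightarrow> (\<lambda>s. s + h) ` J \<subseteq> S \<longrightarrow>
        process_law M J (\<lambda>s. X (s + h)) = process_law M J X)"

definition isotropic ::
    "'w measure \<Rightarrow> 'a::euclidean_space set \<Rightarrow> ('a \<Rightarrow> 'w \<Rightarrow> real) \<Rightarrow> bool" where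
  "isotropic M S X \<longleftrightarrow>
     (\<forall>J Q. finite J \<longrightarrow> J \<subseteq> S \<longrightarrow> orthogonal_transformation Q \<longrightarrow> Q ` J \<subseteq> S \<longrightarrow>
        process_law M J (\<lambda>s. X (Q s)) = process_law M J X)"

text \<open>
  The coordinates \<open>\<omega> 0, \<dots>, \<omega> (n - 1)\<close> of the \<open>n\<close>-fold product space carry \<open>n\<close> independent
  copies of \<open>X\<close>; \<open>c\<close> and \<open>b\<close> are the normalising functions for the maximum of \<open>n\<close> copies.
\<close>

definition max_stable_process ::
    "'w measure \<Rightarrow> 'a set \<Rightarrow> ('a \<Rightarrow> 'w \<Rightarrow> real) \<Rightarrow> bool" where
  "max_stable_process M S X \<longleftrightarrow>
     (\<forall>s\<in>S. X s \<in> borel_measurable M) \<and>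
     (\<forall>n\<ge>1::nat. \<exists>c b :: 'a \<Rightarrow> real. (\<forall>s\<in>S. c s > 0) \<and>
        process_law (PiM {..<n} (\<lambda>_. M)) S
          (\<lambda>s \<omega>. ((MAX i\<in>{..<n}. X s (\<omega> i)) - b s) / c s)
        = process_law M S X)"

definition simple_max_stable_process ::
    "'w measure \<Rightarrow> 'a set \<Rightarrow> ('a \<Rightarrow> 'w \<Rightarrow> real) \<Rightarrow> bool" where
  "simple_max_stable_process M S X \<longleftrightarrow>
     max_stable_process M S X \<and>
     (\<forall>s\<in>S. \<forall>z>0. measure M {\<omega>\<in>space M. X s \<omega> \<le> z} = exp (- 1 / z))"

text \<open>
  The formula is meaningful where \<open>Y' s \<omega> > 0\<close>, which holds almost surely; the values elsewhere
  are irrelevant.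
\<close>

definition inverted_max_stable_process ::
    "'w measure \<Rightarrow> 'a set \<Rightarrow> ('a \<Rightarrow> 'w \<Rightarrow> real) \<Rightarrow> ('a \<Rightarrow> 'w \<Rightarrow> real) \<Rightarrow> bool" where
  "inverted_max_stable_process M S Y' Y \<longleftrightarrow>
     simple_max_stable_process M S Y' \<and>
     (\<forall>s\<in>S. \<forall>\<omega>\<in>space M. Y s \<omega> = - 1 / ln (1 - exp (- (1 / Y' s \<omega>))))"

text \<open>
  \<open>V\<^sub>h(x\<^sub>1, x\<^sub>2)\<close> is the number with \<open>P(X(s) \<le> x\<^sub>1, X(s + h) \<le> x\<^sub>2) = exp (- V\<^sub>h(x\<^sub>1, x\<^sub>2))\<close>
  for every admissible \<open>s\<close>; it exists when the bivariate distributions of \<open>X\<close> are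
  translation invariant, and is unspecified otherwise.
\<close>

definition exponent_measure ::
    "'w measure \<Rightarrow> 'a::euclidean_space set \<Rightarrow> ('a \<Rightarrow> 'w \<Rightarrow> real) \<Rightarrow> 'a \<Rightarrow> real \<Rightarrow> real \<Rightarrow> real" where
  "exponent_measure M S X h x1 x2 =
     (THE v. \<forall>s\<in>S. s + h \<in> S \<longrightarrow>
        measure M {\<omega>\<in>space M. X s \<omega> \<le> x1 \<and> X (s + h) \<omega> \<le> x2} = exp (- v))"

definition extremal_coefficient ::
    "'w measure \<Rightarrow> 'a::euclidean_space set \<Rightarrow> ('a \<Rightarrow> 'w \<Rightarrow> real) \<Rightarrow> 'a \<Rightarrow> real" where
  "extremal_coefficient M S X h = exponent_measure M S X h 1 1"

definition slowly_varying :: "(real \<Rightarrow> real) \<Rightarrow> bool" where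
  "slowly_varying L \<longleftrightarrow>
     L \<in> borel_measurable borel \<and> (\<forall>\<^sub>F x in at_top. L x > 0) \<and>
     (\<forall>t>0. ((\<lambda>x. L (t * x) / L x) \<longlongrightarrow> 1) at_top)"

definition has_tail_dependence_coefficient ::
    "'w measure \<Rightarrow> ('w \<Rightarrow> real) \<Rightarrow> ('w \<Rightarrow> real) \<Rightarrow> real \<Rightarrow> bool" where
  "has_tail_dependence_coefficient M U V \<eta> \<longleftrightarrow>
     \<eta> > 0 \<and>
     (\<exists>L. slowly_varying L \<and>
        (\<lambda>x. measure M {\<omega>\<in>space M. U \<omega> > x \<and> V \<omega> > x}) \<sim>[at_top]
        (\<lambda>x. x powr (- 1 / \<eta>) * L x))"

definition max_mixture ::
    "real \<Rightarrow> ('a \<Rightarrow> 'w \<Rightarrow> real) \<Rightarrow> ('a \<Rightarrow> 'w \<Rightarrow> real) \<Rightarrow> 'a \<Rightarrow> 'w \<Rightarrow> real" where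
  "max_mixture a X Y s \<omega> = max (a * X s \<omega>) ((1 - a) * Y s \<omega>)"

text \<open>The common marginal distribution function; unspecified if the margins differ.\<close>

definition marginal_cdf ::
    "'w measure \<Rightarrow> 'a set \<Rightarrow> ('a \<Rightarrow> 'w \<Rightarrow> real) \<Rightarrow> real \<Rightarrow> real" where
  "marginal_cdf M S Z = (THE F. \<forall>s\<in>S. F = cdf (distr M borel (Z s)))"

definition madogram ::
    "'w measure \<Rightarrow> (real \<Rightarrow> real) \<Rightarrow> real \<Rightarrow> ('a::euclidean_space \<Rightarrow> 'w \<Rightarrow> real) \<Rightarrow> 'a \<Rightarrow> 'a \<Rightarrow> real" where
  "madogram M F l Z s h =
     1 / 2 * (LINT \<omega>|M. \<bar>F (Z s \<omega>) powr l - F (Z (s + h) \<omega>) powr l\<bar>)"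

end

theory Submission
  imports Defs "HOL-Real_Asymp.Real_Asymp"
begin

text \<open>
  Since \<open>\<bar>u - v\<bar> / 2 = max u v - (u + v) / 2\<close> and \<open>F\<close> is increasing, the madogram is
  \<open>E[F(max (Z s) (Z (s + h)))\<^sup>\<lambda>] - 1 / (1 + \<lambda>)\<close>, where \<open>F\<close> is the unit Frechet distribution
  function.  For unit Frechet margins, max-stability can only hold with the normalisation \<open>c = n\<close>,
  \<open>b = 0\<close>, so \<open>g(z) = P(X s \<le> z, X (s + h) \<le> z)\<close> satisfies \<open>g(n z)\<^sup>n = g(z)\<close> and hence
  \<open>g(z) = exp (- \<theta>\<^sub>X / z)\<close>.  The map taking \<open>Y'\<close> to \<open>Y\<close> is a decreasing involution of the positive
  reals, which gives the joint tail of \<open>Y\<close> as \<open>(1 - e\<^bsup>-1/x\<^esup>)\<close> to the power \<open>\<theta>\<^sub>Y\<close> and, by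
  inclusion-exclusion, its joint distribution function.  Independence then yields the law of the
  maximum, and its moment is a Beta integral.
\<close>

section \<open>Pair probabilities read off process laws\<close>

text \<open>The bridge from equality of process laws to equality of bivariate probabilities. The
  case \<open>s = t\<close> is included and supplies the margins.\<close>

lemma process_law_prob2:
  fixes X :: "'a \<Rightarrow> 'w \<Rightarrow> real"
  assumes "\<And>s. s \<in> S \<Longrightarrow> X s \<in> borel_measurable M" "s \<in> S" "t \<in> S"
    and [measurable]: "A \<in> sets borel" "B \<in> sets borel"
  shows "measure (process_law M S X) {f \<in> space (PiM S (\<lambda>_. borel)). f s \<in> A \<and> f t \<in> B}
    = measure M {\<omega> \<in> space M. X s \<omega> \<in> A \<and> X t \<omega> \<in> B}"
proof -
  have m: "(\<lambda>\<omega>. \<lambda>s\<in>S. X s \<omega>) \<in> measurable M (PiM S (\<lambda>_. borel))"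
    by (rule measurable_restrict) (use assms in auto)
  have [measurable]: "s \<in> S" "t \<in> S" by fact+
  have E: "{f \<in> space (PiM S (\<lambda>_. borel)). f s \<in> A \<and> f t \<in> B} \<in> sets (PiM S (\<lambda>_. borel :: real measure))"
    by measurable
  show ?thesis
    unfolding process_law_def measure_distr[OF m E]
    by (rule arg_cong[where f="measure M"]) (use assms in \<open>auto simp: space_PiM\<close>)
qed

text \<open>The shift by \<open>t - s\<close> carries the two-point set \<open>{s, s + h}\<close>
  onto \<open>{t, t + h}\<close>. This invariance is what makes the \<open>THE\<close> in
  \<open>exponent_measure\<close> pick out a value.\<close>

lemma stationary_prob2:
  fixes X :: "'a::euclidean_space \<Rightarrow> 'w \<Rightarrow> real"
  assumes X: "\<And>s. s \<in> S \<Longrightarrow> X s \<in> borel_measurable M" and "stationary M S X"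
    and st: "s \<in> S" "s + h \<in> S" "t \<in> S" "t + h \<in> S" and A: "A \<in> sets borel" "B \<in> sets borel"
  shows "measure M {\<omega> \<in> space M. X t \<omega> \<in> A \<and> X (t + h) \<omega> \<in> B}
       = measure M {\<omega> \<in> space M. X s \<omega> \<in> A \<and> X (s + h) \<omega> \<in> B}"
proof -
  let ?J = "{s, s + h}"
  have shift: "s + (t - s) = t" "s + h + (t - s) = t + h" by (simp_all add: algebra_simps)
  have law: "process_law M ?J (\<lambda>u. X (u + (t - s))) = process_law M ?J X"
    using assms(2)[unfolded stationary_def, rule_format, of ?J "t - s"] st
    by (simp add: shift)
  have m: "X (u + (t - s)) \<in> borel_measurable M" if "u \<in> ?J" for u
  proof -
    from that consider "u = s" | "u = s + h" by auto
    then show ?thesis using st X by cases (simp_all add: shift)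
  qed
  have m': "X u \<in> borel_measurable M" if "u \<in> ?J" for u
    using that st X by auto
  have J: "s \<in> ?J" "s + h \<in> ?J" by auto
  show ?thesis
    using process_law_prob2[of ?J "\<lambda>u. X (u + (t - s))", OF m J A] process_law_prob2[of ?J X, OF m' J A]
    unfolding shift law by simp
qed

section \<open>Real analysis: a scaling equation, beta integrals, the inversion\<close>

lemma Max_affine_le_iff:
  fixes f :: "nat \<Rightarrow> real"
  assumes "n \<ge> 1" "c > 0"
  shows "((MAX i\<in>{..<n}. f i) - b) / c \<le> x \<longleftrightarrow> (\<forall>i<n. f i \<le> c * x + b)"
proof -
  have "((MAX i\<in>{..<n}. f i) - b) / c \<le> x \<longleftrightarrow> (MAX i\<in>{..<n}. f i) \<le> c * x + b"
    using assms by (simp add: field_simps)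
  also have "\<dots> \<longleftrightarrow> (\<forall>i<n. f i \<le> c * x + b)"
    using assms by (subst Max_le_iff) (auto simp: lessThan_empty_iff)
  finally show ?thesis .
qed

text \<open>The scaling law says \<open>ln (g (n * z)) = ln (g z) / n\<close>, which makes
  \<open>z * ln (g z)\<close> constant on the positive rationals. Monotonicity and density of the
  rationals then take the place of continuity of \<open>g\<close>.\<close>

lemma power_scaling_eq_exp:
  fixes g :: "real \<Rightarrow> real"
  assumes mono: "\<And>x y. 0 < x \<Longrightarrow> x \<le> y \<Longrightarrow> g x \<le> g y"
    and scaling: "\<And>n z. n \<ge> 1 \<Longrightarrow> 0 < z \<Longrightarrow> g (real n * z) ^ n = g z"
    and pos: "\<And>z. 0 < z \<Longrightarrow> 0 < g z"
    and z: "0 < z"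
  shows "g z = exp (ln (g 1) / z)"
proof -
  define \<theta> where "\<theta> = - ln (g 1)"
  have sc: "ln (g (real n * z)) = ln (g z) / real n" if "n \<ge> 1" "0 < z" for n z
  proof -
    have "ln (g z) = real n * ln (g (real n * z))"
      using that pos[of "real n * z"] by (simp flip: scaling[OF that] add: ln_realpow)
    then show ?thesis using that by simp
  qed
  have rat: "ln (g q) = - \<theta> / q" if "q \<in> \<rat>" "0 < q" for q
  proof -
    obtain m n :: nat where n: "n \<noteq> 0" and "\<bar>q\<bar> = real m / real n"
      using Rats_abs_nat_div_natE[OF \<open>q \<in> \<rat>\<close>] by metis
    then have q: "q = real m / real n" and m: "m > 0"
      using that by (auto intro!: gr0I)
    \<comment> \<open>The integer \<open>m = n * q\<close> is reached by scaling from
      \<open>q\<close> as well as from \<open>1\<close>; comparing the two values gives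
      \<open>ln (g q)\<close>.\<close>
    have "ln (g (real n * q)) = ln (g q) / real n"
      using n that by (intro sc) auto
    moreover have "real n * q = real m * 1" using q n by simp
    moreover have "ln (g (real m * 1)) = ln (g 1) / real m"
      using m by (intro sc) auto
    ultimately have "ln (g q) / real n = ln (g 1) / real m" by simp
    moreover have "ln (g q) = real n * (ln (g q) / real n)" using n by simp
    ultimately have "ln (g q) = real n * (ln (g 1) / real m)" by simp
    then show ?thesis by (simp add: q \<theta>_def)
  qed
  have \<theta>: "continuous (at z) (\<lambda>x. - \<theta> / x)"
    using z by (intro continuous_intros) auto
  \<comment> \<open>If \<open>ln (g z)\<close> exceeded \<open>- \<theta> / z\<close>, it would
    still exceed \<open>- \<theta> / q = ln (g q)\<close> for a rational \<open>q\<close> slightly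
    to the right of \<open>z\<close>, against monotonicity. The opposite failure is refuted by a
    positive rational slightly to the left.\<close>
  have "ln (g z) = - \<theta> / z"
  proof (rule antisym)
    show "ln (g z) \<le> - \<theta> / z"
    proof (rule ccontr)
      assume "\<not> ?thesis"
      then have "\<forall>\<^sub>F x in at z. - \<theta> / x < ln (g z)"
        using \<theta> by (intro order_tendstoD(2)) (auto simp: continuous_at)
      then have "\<forall>\<^sub>F x in at_right z. - \<theta> / x < ln (g z)"
        by (auto simp: eventually_at_split)
      then obtain b where b: "b > z" "\<And>y. y > z \<Longrightarrow> y < b \<Longrightarrow> - \<theta> / y < ln (g z)"
        unfolding eventually_at_right_field by blast
      obtain q where q: "q \<in> \<rat>" "z < q" "q < b" using Rats_dense_in_real[OF b(1)] by blast
      then have "ln (g z) \<le> ln (g q)"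
        using z by (subst ln_le_cancel_iff) (auto intro!: pos mono)
      with rat[OF q(1)] b(2)[of q] q z show False by auto
    qed
    show "- \<theta> / z \<le> ln (g z)"
    proof (rule ccontr)
      assume "\<not> ?thesis"
      then have "\<forall>\<^sub>F x in at z. ln (g z) < - \<theta> / x"
        using \<theta> by (intro order_tendstoD(1)) (auto simp: continuous_at)
      then have "\<forall>\<^sub>F x in at_left z. ln (g z) < - \<theta> / x"
        by (auto simp: eventually_at_split)
      then obtain b where b: "b < z" "\<And>y. y > b \<Longrightarrow> y < z \<Longrightarrow> ln (g z) < - \<theta> / y"
        unfolding eventually_at_left_field by blast
      have "max b 0 < z" using b(1) z by auto
      then obtain q where q: "q \<in> \<rat>" "max b 0 < q" "q < z" using Rats_dense_in_real by blast
      then have "ln (g q) \<le> ln (g z)"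
        using z by (subst ln_le_cancel_iff) (auto intro!: pos mono)
      with rat[OF q(1)] b(2)[of q] q z show False by auto
    qed
  qed
  then show ?thesis using pos[OF z] by (metis \<theta>_def exp_ln minus_minus)
qed

text \<open>For \<open>q \<ge> 1\<close> the factor \<open>(1 - t) powr (q - 1)\<close> is at most 1
  on the unit interval, so the beta integrand is dominated by \<open>t powr (p - 1)\<close>, whose
  integral is \<open>1 / p\<close>.\<close>

lemma Beta_le_inverse:
  fixes p q :: real
  assumes "p > 0" "q \<ge> 1"
  shows "0 \<le> Beta p q" "Beta p q \<le> 1 / p"
proof -
  have B: "((\<lambda>t. t powr (p - 1) * (1 - t) powr (q - 1)) has_integral Beta p q) {0..1}"
    using assms by (intro has_integral_Beta_real) auto
  have P: "((\<lambda>t. t powr (p - 1)) has_integral 1 / p) {0..1::real}"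
    using has_integral_powr_from_0[of "p - 1" 1] assms by simp
  show "Beta p q \<le> 1 / p"
    by (rule has_integral_le[OF B P]) (use assms in \<open>auto intro!: mult_left_le powr_le1\<close>)
  show "0 \<le> Beta p q"
    by (rule has_integral_nonneg[OF B]) auto
qed

text \<open>The first argument of \<open>Beta\<close> tends to infinity as \<open>b\<close>
  increases to 1, so the bound by its reciprocal \<open>(1 - b) / (b * x + l)\<close> forces the
  beta factor to 0, while the prefactor stays convergent.\<close>

lemma Beta_divide_tendsto_0:
  fixes x y l :: real
  assumes "x \<ge> 0" "y \<ge> 1" "l > 0"
  shows "((\<lambda>b. l * y / ((1 - b) * y + b * x + l) * Beta ((b * x + l) / (1 - b)) y) \<longlongrightarrow> 0) (at_left 1)"
proof -
  have "((\<lambda>b. Beta ((b * x + l) / (1 - b)) y) \<longlongrightarrow> 0) (at_left 1)"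
  proof (rule tendsto_sandwich)
    have ev: "\<forall>\<^sub>F b in at_left (1::real). 0 < b \<and> b < 1"
      using eventually_at_left_field[of "\<lambda>b. 0 < b \<and> b < 1" "1::real"] zero_less_one by blast
    have pos: "(b * x + l) / (1 - b) > 0" if "0 < b \<and> b < 1" for b
      using that assms by (intro divide_pos_pos add_nonneg_pos) auto
    show "\<forall>\<^sub>F b in at_left 1. 0 \<le> Beta ((b * x + l) / (1 - b)) y"
      using ev by eventually_elim (intro Beta_le_inverse pos, auto simp: assms)
    show "\<forall>\<^sub>F b in at_left 1. Beta ((b * x + l) / (1 - b)) y \<le> (1 - b) / (b * x + l)"
      using ev
    proof eventually_elim
      case (elim b)
      then show ?case using Beta_le_inverse(2)[OF pos[OF elim] assms(2)] by simp
    qed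
    have "((\<lambda>b. (1 - b) / (b * x + l)) \<longlongrightarrow> (1 - 1) / (1 * x + l)) (at_left 1)"
      using assms by (intro tendsto_intros) auto
    then show "((\<lambda>b. (1 - b) / (b * x + l)) \<longlongrightarrow> 0) (at_left 1)" by simp
  qed auto
  moreover have "((\<lambda>b. l * y / ((1 - b) * y + b * x + l)) \<longlongrightarrow> l * y / ((1 - 1) * y + 1 * x + l)) (at_left 1)"
    using assms by (intro tendsto_intros) auto
  ultimately show ?thesis
    using tendsto_mult by fastforce
qed

text \<open>The summand \<open>(1 - t) powr q\<close> contributes \<open>Beta p (q + 1)\<close>, and
  the recurrence of the beta function in its second argument turns this into the multiple of
  \<open>Beta p q\<close> that appears in the madogram.\<close>

lemma has_integral_powr_Beta:
  fixes p q :: real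
  assumes "p > 0" "q > 0"
  shows "((\<lambda>t. t powr (p - 1) * (2 * t - 1 + (1 - t) powr q)) has_integral
    (2 / (p + 1) - 1 / p + q / (p + q) * Beta p q)) {0..1}"
proof -
  have pow: "((\<lambda>t. t powr (r - 1)) has_integral (1 / r)) {0..1::real}" if "r > 0" for r :: real
    using has_integral_powr_from_0[of "r - 1" 1] that by simp
  have "p \<notin> \<int>\<^sub>\<le>\<^sub>0" "q \<notin> \<int>\<^sub>\<le>\<^sub>0"
    using assms by (auto elim!: nonpos_Ints_cases)
  then have "(p + q) * Beta p (q + 1) = q * Beta p q"
    using Beta_plus1_right[of q p] assms by auto
  then have B: "Beta p (q + 1) = q / (p + q) * Beta p q"
    using assms by (simp add: field_simps)
  have "((\<lambda>t. 2 * t powr (p + 1 - 1) - t powr (p - 1) + t powr (p - 1) * (1 - t) powr (q + 1 - 1)) has_integral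
      (2 * (1 / (p + 1)) - 1 / p + Beta p (q + 1))) {0..1}"
    using assms by (intro has_integral_add has_integral_diff has_integral_mult_right pow has_integral_Beta_real) auto
  then show ?thesis
  proof (rule has_integral_eq_rhs[OF has_integral_eq, rotated 1])
    fix t :: real assume t: "t \<in> {0..1}"
    have "t powr p = t powr (p - 1) * t"
      using powr_add[of t "p - 1" 1] t by simp
    then show "2 * t powr (p + 1 - 1) - t powr (p - 1) + t powr (p - 1) * (1 - t) powr (q + 1 - 1)
        = t powr (p - 1) * (2 * t - 1 + (1 - t) powr q)"
      by (simp add: algebra_simps)
  qed (simp add: B)
qed

text \<open>Both sides are equivalent to \<open>exp (- (1 / x)) + exp (- (1 / w)) < 1\<close>, a
  condition symmetric in \<open>w\<close> and \<open>x\<close>.\<close>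

lemma less_inverted_iff:
  fixes w x :: real
  assumes "w > 0" "x > 0"
  shows "x < - 1 / ln (1 - exp (- (1 / w))) \<longleftrightarrow> w < - 1 / ln (1 - exp (- (1 / x)))"
proof -
  have *: "x < - 1 / ln (1 - exp (- (1 / w))) \<longleftrightarrow> exp (- (1 / x)) + exp (- (1 / w)) < 1"
    if "w > 0" "x > 0" for w x :: real
  proof -
    have e: "0 < 1 - exp (- (1 / w))" "1 - exp (- (1 / w)) < 1" using that by auto
    then have L: "ln (1 - exp (- (1 / w))) < 0" by simp
    have "x < - 1 / ln (1 - exp (- (1 / w))) \<longleftrightarrow> - (1 / x) < ln (1 - exp (- (1 / w)))"
      using L that(2) by (simp add: field_simps)
    also have "\<dots> \<longleftrightarrow> exp (- (1 / x)) < 1 - exp (- (1 / w))"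
      using e by (metis exp_less_cancel_iff exp_ln)
    finally show ?thesis by linarith
  qed
  show ?thesis using *[OF assms] *[OF assms(2,1)] by linarith
qed

lemma one_minus_exp_inverse_asymp_equiv:
  "(\<lambda>x::real. (1 - exp (- (1 / x))) powr \<theta>) \<sim>[at_top] (\<lambda>x. x powr - \<theta>)"
  by real_asymp

section \<open>The unit Frechet distribution function\<close>

text \<open>The case split is essential: the expression \<open>exp (- 1 / x)\<close> exceeds 1 for
  negative \<open>x\<close>, and equals 1 at 0 because division by zero yields 0.\<close>

definition frechet_cdf :: "real \<Rightarrow> real" where
  "frechet_cdf x = (if x > 0 then exp (- 1 / x) else 0)"

lemma frechet_cdf_range: "0 \<le> frechet_cdf x" "frechet_cdf x \<le> 1"
  by (auto simp: frechet_cdf_def)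

lemma frechet_cdf_mono: "mono frechet_cdf"
  by (rule monoI) (auto simp: frechet_cdf_def field_simps)

lemma frechet_cdf_measurable [measurable]: "frechet_cdf \<in> borel_measurable borel"
  by (rule borel_measurable_mono[OF frechet_cdf_mono])

text \<open>The number \<open>- 1 / ln u\<close> is the unit Frechet quantile of level
  \<open>u\<close>. It is positive, so both sides hold for \<open>x \<le> 0\<close>.\<close>

lemma frechet_cdf_le_iff:
  assumes "0 < u" "u < 1"
  shows "frechet_cdf x \<le> u \<longleftrightarrow> x \<le> - 1 / ln u"
proof -
  have L: "ln u < 0" using assms by simp
  show ?thesis
  proof (cases "x > 0")
    case True
    have "exp (- 1 / x) \<le> u \<longleftrightarrow> - 1 / x \<le> ln u"
      using assms by (simp add: ln_ge_iff)
    also have "\<dots> \<longleftrightarrow> x \<le> - 1 / ln u"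
      using L True by (simp add: field_simps)
    finally show ?thesis using True by (simp add: frechet_cdf_def)
  next
    case False
    have "- 1 / ln u > 0" using L by (simp add: field_simps)
    then have "x \<le> - 1 / ln u" using False by linarith
    then show ?thesis using False assms by (simp add: frechet_cdf_def)
  qed
qed

context prob_space
begin

section \<open>Max-stability for pairs and the moment formula\<close>

text \<open>A maximum of \<open>n\<close> copies stays below a level iff every copy does, so the
  event in the product space is a box with equal sides and its probability is an \<open>n\<close>-th
  power.\<close>

lemma max_stable_process_prob2:
  assumes "max_stable_process M S X" "n \<ge> 1"
  obtains c b where "\<And>s. s \<in> S \<Longrightarrow> c s > (0::real)"
    "\<And>s t x y. s \<in> S \<Longrightarrow> t \<in> S \<Longrightarrow>
       prob {\<omega> \<in> space M. X s \<omega> \<le> c s * x + b s \<and> X t \<omega> \<le> c t * y + b t} ^ n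
       = prob {\<omega> \<in> space M. X s \<omega> \<le> x \<and> X t \<omega> \<le> y}"
proof -
  have X[measurable]: "\<And>s. s \<in> S \<Longrightarrow> X s \<in> borel_measurable M"
    using assms by (auto simp: max_stable_process_def)
  obtain c b where c: "\<And>s. s \<in> S \<Longrightarrow> c s > (0::real)"
    and law: "process_law (PiM {..<n} (\<lambda>_. M)) S (\<lambda>s \<omega>. ((MAX i\<in>{..<n}. X s (\<omega> i)) - b s) / c s)
        = process_law M S X"
    using assms unfolding max_stable_process_def by blast
  interpret P: finite_product_prob_space "\<lambda>_. M" "{..<n}"
    by unfold_locales auto
  show thesis
  proof (rule that[of c b])
    fix s t x y assume st: "s \<in> S" "t \<in> S"
    let ?N = "\<lambda>s \<omega>. ((MAX i\<in>{..<n}. X s (\<omega> i)) - b s) / c s"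
    let ?E = "{\<omega> \<in> space M. X s \<omega> \<le> c s * x + b s \<and> X t \<omega> \<le> c t * y + b t}"
    have E: "?E \<in> events"
      using X[OF st(1)] X[OF st(2)] by measurable
    have N: "?N s \<in> borel_measurable (PiM {..<n} (\<lambda>_. M))" if "s \<in> S" for s
    proof -
      have [measurable]: "X s \<in> borel_measurable M" by (rule X[OF that])
      have [measurable]: "(\<lambda>\<omega>. MAX i\<in>{..<n}. X s (\<omega> i)) \<in> borel_measurable (PiM {..<n} (\<lambda>_. M))"
        by (rule borel_measurable_Max) auto
      show ?thesis by measurable
    qed
    have "{\<omega> \<in> space (PiM {..<n} (\<lambda>_. M)). ?N s \<omega> \<le> x \<and> ?N t \<omega> \<le> y} = (\<Pi>\<^sub>E i\<in>{..<n}. ?E)"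
      (is "?L = ?R")
    proof (rule set_eqI)
      fix \<omega>
      have "\<omega> \<in> ?L \<longleftrightarrow> \<omega> \<in> extensional {..<n} \<and> (\<forall>i<n. \<omega> i \<in> space M) \<and>
          (\<forall>i<n. X s (\<omega> i) \<le> c s * x + b s) \<and> (\<forall>i<n. X t (\<omega> i) \<le> c t * y + b t)"
        unfolding mem_Collect_eq Max_affine_le_iff[OF assms(2) c[OF st(1)]]
          Max_affine_le_iff[OF assms(2) c[OF st(2)]] space_PiM PiE_iff by blast
      also have "\<dots> \<longleftrightarrow> \<omega> \<in> ?R"
        unfolding PiE_iff by blast
      finally show "\<omega> \<in> ?L \<longleftrightarrow> \<omega> \<in> ?R" .
    qed
    moreover have "measure (PiM {..<n} (\<lambda>_. M)) (\<Pi>\<^sub>E i\<in>{..<n}. ?E) = prob ?E ^ n"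
      using P.prob_times[of "\<lambda>_. ?E"] E by simp
    ultimately have "measure (process_law (PiM {..<n} (\<lambda>_. M)) S ?N)
        {f \<in> space (PiM S (\<lambda>_. borel)). f s \<in> {..x} \<and> f t \<in> {..y}} = prob ?E ^ n"
      by (subst process_law_prob2[OF N st]) auto
    then show "prob ?E ^ n = prob {\<omega> \<in> space M. X s \<omega> \<le> x \<and> X t \<omega> \<le> y}"
      unfolding law using process_law_prob2[OF X st, where A="{..x}" and B="{..y}"] by simp
  qed (use c in auto)
qed

text \<open>The layer-cake formula for a variable with values in the unit interval. The distribution
  function is prescribed only for \<open>0 < t < 1\<close>, since the endpoints form a null set for
  the integral.\<close>

lemma expectation_powr:
  fixes W :: "'a \<Rightarrow> real"
  assumes W[measurable]: "W \<in> borel_measurable M"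
    and bounds: "\<And>\<omega>. \<omega> \<in> space M \<Longrightarrow> 0 \<le> W \<omega> \<and> W \<omega> \<le> 1"
    and r: "r > 0"
    and K: "\<And>t. 0 < t \<Longrightarrow> t < 1 \<Longrightarrow> prob {\<omega> \<in> space M. W \<omega> \<le> t} = K t"
    and I: "((\<lambda>t. t powr (r - 1) * K t) has_integral I) {0..1}"
  shows "expectation (\<lambda>\<omega>. W \<omega> powr r) = 1 - r * I"
proof -
  define J where "J = {0<..<1::real}"
  define f where "f t \<omega> = r * t powr (r - 1) * indicator J t * indicator {\<omega> \<in> space M. t < W \<omega>} \<omega>" for t \<omega>
  have pow: "((\<lambda>t. t powr (r - 1)) has_integral (w powr r / r)) {0..w}" if "0 \<le> w" for w
    using has_integral_powr_from_0[of "r - 1" w] r that by simp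
  interpret L: pair_sigma_finite lborel M
    by unfold_locales
  have f_meas: "case_prod (\<lambda>t \<omega>. ennreal (f t \<omega>)) \<in> borel_measurable (lborel \<Otimes>\<^sub>M M)"
    unfolding f_def J_def indicator_def by measurable
  \<comment> \<open>\<open>W\<^sup>r\<close> is the integral of \<open>r t\<^bsup>r - 1\<^esup>\<close> over \<open>0 < t < W\<close>; swap the integrals.\<close>
  have in1: "(\<integral>\<^sup>+ t. ennreal (f t \<omega>) \<partial>lborel) = ennreal (W \<omega> powr r)" if w: "\<omega> \<in> space M" for \<omega>
  proof (rule nn_integral_has_integral_lborel)
    show "(\<lambda>t. f t \<omega>) \<in> borel_measurable borel"
      unfolding f_def J_def indicator_def using w by measurable
    have "((\<lambda>t. r * t powr (r - 1)) has_integral r * (W \<omega> powr r / r)) {0<..<W \<omega>}"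
      using pow[of "W \<omega>"] bounds[OF w] by (intro has_integral_mult_right) (auto simp: has_integral_Icc_iff_Ioo)
    then have "((\<lambda>t. if t \<in> {0<..<W \<omega>} then r * t powr (r - 1) else 0) has_integral W \<omega> powr r) UNIV"
      using r by (subst has_integral_restrict_UNIV) auto
    moreover have "(\<lambda>t. if t \<in> {0<..<W \<omega>} then r * t powr (r - 1) else 0) = (\<lambda>t. f t \<omega>)"
      using bounds[OF w] w by (auto simp: f_def J_def indicator_def fun_eq_iff)
    ultimately show "((\<lambda>t. f t \<omega>) has_integral W \<omega> powr r) UNIV" by simp
  qed (use r in \<open>auto simp: f_def\<close>)
  have tail: "prob {\<omega> \<in> space M. t < W \<omega>} = 1 - K t" if "t \<in> J" for t
  proof -
    have "{\<omega> \<in> space M. t < W \<omega>} = space M - {\<omega> \<in> space M. W \<omega> \<le> t}" by auto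
    then show ?thesis using prob_compl[of "{\<omega> \<in> space M. W \<omega> \<le> t}"] K[of t] that
      by (simp add: J_def)
  qed
  define k where "k t = r * t powr (r - 1) * indicator J t * prob {\<omega> \<in> space M. t < W \<omega>}" for t
  have in2: "(\<integral>\<^sup>+ \<omega>. ennreal (f t \<omega>) \<partial>M) = ennreal (k t)" for t
  proof -
    have "(\<integral>\<^sup>+ \<omega>. ennreal (f t \<omega>) \<partial>M)
        = (\<integral>\<^sup>+ \<omega>. ennreal (r * t powr (r - 1) * indicator J t) * indicator {\<omega> \<in> space M. t < W \<omega>} \<omega> \<partial>M)"
      unfolding f_def using r by (intro nn_integral_cong) (simp add: ennreal_mult' indicator_def)
    also have "\<dots> = ennreal (r * t powr (r - 1) * indicator J t) * emeasure M {\<omega> \<in> space M. t < W \<omega>}"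
      by (intro nn_integral_cmult_indicator) measurable
    finally show ?thesis using r by (simp add: k_def ennreal_mult' emeasure_eq_measure)
  qed
  \<comment> \<open>Nothing is assumed about measurability of \<open>K\<close>; it comes from
    monotonicity of the tail probability in \<open>t\<close>.\<close>
  have k_meas: "k \<in> borel_measurable borel"
  proof -
    have "mono (\<lambda>t. - prob {\<omega> \<in> space M. t < W \<omega>})"
      by (rule monoI) (auto intro!: finite_measure_mono)
    then have "(\<lambda>t. - prob {\<omega> \<in> space M. t < W \<omega>}) \<in> borel_measurable borel"
      by (rule borel_measurable_mono)
    then have "(\<lambda>t. - (- prob {\<omega> \<in> space M. t < W \<omega>})) \<in> borel_measurable borel"
      by (rule borel_measurable_uminus)
    then show ?thesis unfolding k_def J_def by simp
  qed
  have "((\<lambda>t. r * (t powr (r - 1) - t powr (r - 1) * K t)) has_integral (r * (1 powr r / r - I))) {0..1}"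
    by (intro has_integral_mult_right has_integral_diff pow I) auto
  then have "((\<lambda>t. r * (t powr (r - 1) - t powr (r - 1) * K t)) has_integral (1 - r * I)) J"
    using r unfolding J_def by (simp add: has_integral_Icc_iff_Ioo right_diff_distrib)
  then have "((\<lambda>t. if t \<in> J then r * (t powr (r - 1) - t powr (r - 1) * K t) else 0) has_integral (1 - r * I)) UNIV"
    by (subst has_integral_restrict_UNIV)
  moreover have "(\<lambda>t. if t \<in> J then r * (t powr (r - 1) - t powr (r - 1) * K t) else 0) = k"
    by (auto simp: fun_eq_iff k_def indicator_def tail algebra_simps)
  ultimately have kI: "(k has_integral (1 - r * I)) UNIV" by simp
  have k0: "0 \<le> k t" for t using r by (simp add: k_def)
  have "(\<integral>\<^sup>+ \<omega>. ennreal (W \<omega> powr r) \<partial>M) = (\<integral>\<^sup>+ \<omega>. (\<integral>\<^sup>+ t. ennreal (f t \<omega>) \<partial>lborel) \<partial>M)"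
    by (intro nn_integral_cong) (simp add: in1)
  also have "\<dots> = (\<integral>\<^sup>+ t. (\<integral>\<^sup>+ \<omega>. ennreal (f t \<omega>) \<partial>M) \<partial>lborel)"
    by (rule L.Fubini'[OF f_meas])
  also have "\<dots> = ennreal (1 - r * I)"
    unfolding in2 by (rule nn_integral_has_integral_lborel[OF k_meas k0 kI])
  finally have "(\<integral>\<^sup>+ \<omega>. ennreal (W \<omega> powr r) \<partial>M) = ennreal (1 - r * I)" .
  moreover have "0 \<le> 1 - r * I" by (rule has_integral_nonneg[OF kI]) (rule k0)
  ultimately show ?thesis
    by (intro integral_eq_nn_integral[THEN trans]) auto
qed

section \<open>Frechet variables with a scale parameter\<close>

text \<open>The Frechet law of shape 1 and scale \<open>\<theta>\<close>. Both the margins (scale 1)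
  and the pair maxima of a simple max-stable process (scale the extremal coefficient) are of this
  form.\<close>

definition frechet :: "real \<Rightarrow> ('a \<Rightarrow> real) \<Rightarrow> bool" where
  "frechet \<theta> U \<longleftrightarrow> U \<in> borel_measurable M \<and>
     (\<forall>z>0. prob {\<omega> \<in> space M. U \<omega> \<le> z} = exp (- \<theta> / z))"

lemma frechet_measurable: "frechet \<theta> U \<Longrightarrow> U \<in> borel_measurable M"
  and frechet_prob_le: "frechet \<theta> U \<Longrightarrow> z > 0 \<Longrightarrow> prob {\<omega> \<in> space M. U \<omega> \<le> z} = exp (- \<theta> / z)"
  by (auto simp: frechet_def)

text \<open>The probability is at most \<open>exp (- \<theta> / z)\<close> for every
  \<open>z > 0\<close>, and this tends to 0 as \<open>z\<close> decreases to 0.\<close>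

lemma frechet_prob_nonpos:
  assumes "frechet \<theta> U" "\<theta> > 0" "x \<le> 0"
  shows "prob {\<omega> \<in> space M. U \<omega> \<le> x} = 0"
proof -
  have [measurable]: "U \<in> borel_measurable M" using assms by (simp add: frechet_measurable)
  have "prob {\<omega> \<in> space M. U \<omega> \<le> x} \<le> 0"
  proof (rule tendsto_lowerbound)
    show "((\<lambda>z. exp (- \<theta> / z)) \<longlongrightarrow> 0) (at_right 0)"
      using assms(2) by real_asymp
    show "\<forall>\<^sub>F z in at_right 0. prob {\<omega> \<in> space M. U \<omega> \<le> x} \<le> exp (- \<theta> / z)"
      using eventually_at_right_less[of "0::real"]
    proof eventually_elim
      case (elim z)
      have "prob {\<omega> \<in> space M. U \<omega> \<le> x} \<le> prob {\<omega> \<in> space M. U \<omega> \<le> z}"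
        using elim assms(3) by (intro finite_measure_mono) auto
      then show ?case using elim assms(1) by (simp add: frechet_prob_le)
    qed
  qed auto
  then show ?thesis by (simp add: measure_le_0_iff)
qed

lemma frechet_AE_pos:
  assumes "frechet \<theta> U" "\<theta> > 0"
  shows "AE \<omega> in M. 0 < U \<omega>"
proof -
  have [measurable]: "U \<in> borel_measurable M" using assms by (simp add: frechet_measurable)
  have "{\<omega> \<in> space M. U \<omega> \<le> 0} \<in> null_sets M"
    using frechet_prob_nonpos[OF assms, of 0] by (intro null_setsI) (auto simp: emeasure_eq_measure)
  from AE_not_in[OF this] AE_space show ?thesis by eventually_elim auto
qed

text \<open>There is no atom at \<open>z\<close>, because the distribution function is
  left-continuous there. The strict form matches the strict exceedances of the inverted
  process.\<close>

lemma frechet_prob_less: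
  assumes "frechet \<theta> U" "z > 0"
  shows "prob {\<omega> \<in> space M. U \<omega> < z} = exp (- \<theta> / z)"
proof (rule antisym)
  have [measurable]: "U \<in> borel_measurable M" using assms by (simp add: frechet_measurable)
  have "prob {\<omega> \<in> space M. U \<omega> < z} \<le> prob {\<omega> \<in> space M. U \<omega> \<le> z}"
    by (intro finite_measure_mono) auto
  then show "prob {\<omega> \<in> space M. U \<omega> < z} \<le> exp (- \<theta> / z)"
    using assms by (simp add: frechet_prob_le)
  show "exp (- \<theta> / z) \<le> prob {\<omega> \<in> space M. U \<omega> < z}"
  proof (rule tendsto_upperbound)
    show "((\<lambda>y. exp (- \<theta> / y)) \<longlongrightarrow> exp (- \<theta> / z)) (at_left z)"
      using assms(2) by (intro tendsto_intros) auto
    have "\<forall>\<^sub>F y in at_left z. 0 < y \<and> y < z"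
      using assms(2) unfolding eventually_at_left_field by blast
    then show "\<forall>\<^sub>F y in at_left z. exp (- \<theta> / y) \<le> prob {\<omega> \<in> space M. U \<omega> < z}"
    proof eventually_elim
      case (elim y)
      have "prob {\<omega> \<in> space M. U \<omega> \<le> y} \<le> prob {\<omega> \<in> space M. U \<omega> < z}"
        using elim by (intro finite_measure_mono) auto
      then show ?case using elim assms(1) by (simp add: frechet_prob_le)
    qed
  qed auto
qed

section \<open>Pairs of a simple max-stable process\<close>

lemma simple_max_stable_frechet:
  assumes "simple_max_stable_process M S X" "s \<in> S"
  shows "frechet 1 (X s)"
  using assms by (auto simp: simple_max_stable_process_def max_stable_process_def frechet_def)

lemma simple_max_stable_scaling:
  assumes X: "simple_max_stable_process M S X" and st: "s \<in> S" "t \<in> S" and n: "n \<ge> 1" and z: "z > 0"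
  shows "prob {\<omega> \<in> space M. X s \<omega> \<le> real n * z \<and> X t \<omega> \<le> real n * z} ^ n
       = prob {\<omega> \<in> space M. X s \<omega> \<le> z \<and> X t \<omega> \<le> z}"
proof -
  have ms: "max_stable_process M S X" using X by (simp add: simple_max_stable_process_def)
  obtain c b where c: "\<And>s. s \<in> S \<Longrightarrow> c s > (0::real)" and
    cb: "\<And>s t x y. s \<in> S \<Longrightarrow> t \<in> S \<Longrightarrow>
       prob {\<omega> \<in> space M. X s \<omega> \<le> c s * x + b s \<and> X t \<omega> \<le> c t * y + b t} ^ n
       = prob {\<omega> \<in> space M. X s \<omega> \<le> x \<and> X t \<omega> \<le> y}"
    by (rule max_stable_process_prob2[OF ms n]) (rule that; assumption)
  \<comment> \<open>The Frechet margins pin down the normalisation.\<close>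
  have norm: "c s * z + b s = real n * z" if s: "s \<in> S" for s
  proof -
    note fr = simple_max_stable_frechet[OF X s]
    have eq: "prob {\<omega> \<in> space M. X s \<omega> \<le> c s * z + b s} ^ n = exp (- 1 / z)"
      using cb[OF s s, of z z] frechet_prob_le[OF fr z] by simp
    \<comment> \<open>At a nonpositive level the probability would be 0, and so would its
      \<open>n\<close>-th power as \<open>n \<ge> 1\<close>; but that power is
      \<open>exp (- 1 / z)\<close>.\<close>
    have pos: "c s * z + b s > 0"
    proof (rule ccontr)
      assume "\<not> ?thesis"
      then have "prob {\<omega> \<in> space M. X s \<omega> \<le> c s * z + b s} = 0"
        by (intro frechet_prob_nonpos[OF fr]) auto
      then show False using eq n by (simp add: power_0_left)
    qed
    have "exp (- 1 / (c s * z + b s)) ^ n = exp (- 1 / z)"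
      using eq frechet_prob_le[OF fr pos] by simp
    then have "real n * (- 1 / (c s * z + b s)) = - 1 / z"
      by (simp flip: exp_of_nat_mult)
    then show ?thesis using z pos by (simp add: field_simps)
  qed
  show ?thesis using cb[OF st, of z z] unfolding norm[OF st(1)] norm[OF st(2)] .
qed

text \<open>This is homogeneity of order -1 of the exponent measure on the diagonal. At this stage
  \<open>\<theta>\<close> belongs to the single pair \<open>(s, t)\<close>; translation invariance
  enters only when it is identified with \<open>extremal_coefficient\<close>.\<close>

lemma simple_max_stable_pair_frechet:
  assumes X: "simple_max_stable_process M S X" and st: "s \<in> S" "t \<in> S"
  obtains \<theta> where "\<theta> \<ge> 1" "frechet \<theta> (\<lambda>\<omega>. max (X s \<omega>) (X t \<omega>))"
proof -
  note fr = simple_max_stable_frechet[OF X]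
  have [measurable]: "X s \<in> borel_measurable M" "X t \<in> borel_measurable M"
    using fr st by (auto intro: frechet_measurable)
  define g where "g z = prob {\<omega> \<in> space M. X s \<omega> \<le> z \<and> X t \<omega> \<le> z}" for z
  have mono: "g x \<le> g y" if "x \<le> y" for x y
    unfolding g_def using that by (intro finite_measure_mono) auto
  have scaling: "g (real n * z) ^ n = g z" if "n \<ge> 1" "z > 0" for n z
    unfolding g_def by (rule simple_max_stable_scaling[OF X st that])
  \<comment> \<open>The margins alone give \<open>g y \<ge> 2 * exp (- 1 / y) - 1\<close>, which is
    positive at \<open>y = n * z\<close> for large \<open>n\<close>; the scaling law carries
    positivity back to \<open>z\<close>.\<close>
  have pos: "g z > 0" if z: "z > 0" for z
  proof -
    have "((\<lambda>n. 2 * exp (- 1 / (real n * z))) \<longlongrightarrow> 2) sequentially"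
      using z by real_asymp
    then have "\<forall>\<^sub>F n in sequentially. 1 < 2 * exp (- 1 / (real n * z))"
      by (rule order_tendstoD) simp
    then have "\<forall>\<^sub>F n in sequentially. 1 < 2 * exp (- 1 / (real n * z)) \<and> n \<ge> 1"
      using eventually_ge_at_top[of 1] by eventually_elim auto
    then obtain n :: nat where n: "1 < 2 * exp (- 1 / (real n * z))" "n \<ge> 1"
      using eventually_happens'[OF sequentially_bot] by blast
    let ?y = "real n * z"
    have y: "?y > 0" using n z by simp
    have "prob {\<omega> \<in> space M. X s \<omega> \<le> ?y} \<le>
        prob ({\<omega> \<in> space M. X s \<omega> \<le> ?y \<and> X t \<omega> \<le> ?y} \<union> (space M - {\<omega> \<in> space M. X t \<omega> \<le> ?y}))"
      by (intro finite_measure_mono) auto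
    also have "\<dots> \<le> g ?y + prob (space M - {\<omega> \<in> space M. X t \<omega> \<le> ?y})"
      unfolding g_def by (intro measure_Un_le) auto
    also have "prob (space M - {\<omega> \<in> space M. X t \<omega> \<le> ?y}) = 1 - exp (- 1 / ?y)"
      using frechet_prob_le[OF fr[OF st(2)] y] by (subst prob_compl) auto
    finally have "g ?y > 0"
      using n(1) frechet_prob_le[OF fr[OF st(1)] y] by simp
    then show ?thesis unfolding scaling[OF n(2) z, symmetric] by simp
  qed
  define \<theta> where "\<theta> = - ln (g 1)"
  have g: "g z = exp (- \<theta> / z)" if "z > 0" for z
    using power_scaling_eq_exp[of g z, OF mono scaling pos that] by (simp add: \<theta>_def)
  show thesis
  proof (rule that)
    \<comment> \<open>Comparison with one margin gives \<open>g 1 \<le> exp (- 1)\<close>, that is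
      \<open>\<theta> \<ge> 1\<close>.\<close>
    have "g 1 \<le> prob {\<omega> \<in> space M. X s \<omega> \<le> 1}"
      unfolding g_def by (intro finite_measure_mono) auto
    then have g1: "g 1 \<le> exp (- 1)"
      using frechet_prob_le[OF fr[OF st(1)], of 1] by simp
    have "ln (g 1) \<le> - 1"
      using ln_mono[OF g1 pos[of 1]] by simp
    then show "\<theta> \<ge> 1" by (simp add: \<theta>_def)
    show "frechet \<theta> (\<lambda>\<omega>. max (X s \<omega>) (X t \<omega>))"
      unfolding frechet_def using g unfolding g_def by simp
  qed
qed

text \<open>By \<open>inv\<close>, the scale of the pair \<open>(s, s + h)\<close> serves every
  admissible \<open>t\<close> at level 1, and injectivity of \<open>exp\<close> makes it the only
  candidate for the \<open>THE\<close>.\<close>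

lemma extremal_coefficient_frechet:
  fixes X :: "'b::euclidean_space \<Rightarrow> 'a \<Rightarrow> real"
  assumes X: "simple_max_stable_process M S X" and s: "s \<in> S" "s + h \<in> S"
    and inv: "\<And>t. t \<in> S \<Longrightarrow> t + h \<in> S \<Longrightarrow>
      prob {\<omega> \<in> space M. X t \<omega> \<le> 1 \<and> X (t + h) \<omega> \<le> 1}
      = prob {\<omega> \<in> space M. X s \<omega> \<le> 1 \<and> X (s + h) \<omega> \<le> 1}"
  shows "extremal_coefficient M S X h \<ge> 1"
    "frechet (extremal_coefficient M S X h) (\<lambda>\<omega>. max (X s \<omega>) (X (s + h) \<omega>))"
proof -
  obtain \<theta> where \<theta>: "\<theta> \<ge> 1" "frechet \<theta> (\<lambda>\<omega>. max (X s \<omega>) (X (s + h) \<omega>))"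
    using simple_max_stable_pair_frechet[OF X s] .
  have "prob {\<omega> \<in> space M. X s \<omega> \<le> 1 \<and> X (s + h) \<omega> \<le> 1} = exp (- \<theta>)"
    using frechet_prob_le[OF \<theta>(2), of 1] by simp
  then have val: "prob {\<omega> \<in> space M. X t \<omega> \<le> 1 \<and> X (t + h) \<omega> \<le> 1} = exp (- \<theta>)"
    if "t \<in> S" "t + h \<in> S" for t
    using inv[OF that] by metis
  have "extremal_coefficient M S X h = \<theta>"
    unfolding extremal_coefficient_def exponent_measure_def
  proof (rule the_equality)
    fix v assume "\<forall>t\<in>S. t + h \<in> S \<longrightarrow>
      prob {\<omega> \<in> space M. X t \<omega> \<le> 1 \<and> X (t + h) \<omega> \<le> 1} = exp (- v)"
    then show "v = \<theta>" using val[OF s] s by simp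
  qed (use val in blast)
  with \<theta> show "extremal_coefficient M S X h \<ge> 1"
    "frechet (extremal_coefficient M S X h) (\<lambda>\<omega>. max (X s \<omega>) (X (s + h) \<omega>))" by auto
qed

section \<open>Independence, and the law of the inverted process\<close>

text \<open>Both pair events are preimages of cylinder sets under the path maps whose independence
  is assumed.\<close>

lemma independent_processes_prob2:
  fixes X Y :: "'b \<Rightarrow> 'a \<Rightarrow> real"
  assumes ind: "independent_processes M S X Y" and st[measurable]: "s \<in> S" "t \<in> S"
    and [measurable]: "A \<in> sets borel" "B \<in> sets borel"
  shows "prob {\<omega> \<in> space M. (X s \<omega> \<in> A \<and> X t \<omega> \<in> A) \<and> (Y s \<omega> \<in> B \<and> Y t \<omega> \<in> B)}
       = prob {\<omega> \<in> space M. X s \<omega> \<in> A \<and> X t \<omega> \<in> A} * prob {\<omega> \<in> space M. Y s \<omega> \<in> B \<and> Y t \<omega> \<in> B}"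
proof -
  let ?P = "PiM S (\<lambda>_. borel :: real measure)"
  let ?X = "\<lambda>\<omega>. \<lambda>s\<in>S. X s \<omega>" and ?Y = "\<lambda>\<omega>. \<lambda>s\<in>S. Y s \<omega>"
  let ?A = "\<lambda>A. {f \<in> space ?P. f s \<in> A \<and> f t \<in> A}"
  have A: "?A A \<in> sets ?P" by measurable
  have B: "?A B \<in> sets ?P" by measurable
  note eq = indep_varD[OF ind[unfolded independent_processes_def] A B]
  have mem: "?X \<omega> \<in> ?A A \<longleftrightarrow> X s \<omega> \<in> A \<and> X t \<omega> \<in> A"
    "?Y \<omega> \<in> ?A B \<longleftrightarrow> Y s \<omega> \<in> B \<and> Y t \<omega> \<in> B" for \<omega>
    using st by (simp_all add: space_PiM)
  have vim: "?X -` ?A A \<inter> space M = {\<omega> \<in> space M. X s \<omega> \<in> A \<and> X t \<omega> \<in> A}"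
    "?Y -` ?A B \<inter> space M = {\<omega> \<in> space M. Y s \<omega> \<in> B \<and> Y t \<omega> \<in> B}"
    "(\<lambda>\<omega>. (?X \<omega>, ?Y \<omega>)) -` (?A A \<times> ?A B) \<inter> space M
      = {\<omega> \<in> space M. (X s \<omega> \<in> A \<and> X t \<omega> \<in> A) \<and> (Y s \<omega> \<in> B \<and> Y t \<omega> \<in> B)}"
    unfolding vimage_def mem_Times_iff fst_conv snd_conv mem by blast+
  show ?thesis using eq unfolding vim .
qed

lemma inverted_max_stable_measurable:
  assumes "inverted_max_stable_process M S Y' Y" "s \<in> S"
  shows "Y s \<in> borel_measurable M"
proof -
  have "simple_max_stable_process M S Y'" using assms by (simp add: inverted_max_stable_process_def)
  note frechet_measurable[OF simple_max_stable_frechet[OF this assms(2)], measurable]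
  have "(\<lambda>\<omega>. - 1 / ln (1 - exp (- (1 / Y' s \<omega>)))) \<in> borel_measurable M"
    by measurable
  then show ?thesis
    by (rule measurable_cong[THEN iffD1, rotated]) (use assms in \<open>auto simp: inverted_max_stable_process_def\<close>)
qed

text \<open>Exceedance of \<open>x\<close> by both values of \<open>Y\<close> means that the maximum
  of the \<open>Y'\<close> pair lies below the inverted level \<open>?v\<close>, and
  \<open>- \<theta> / ?v\<close> is \<open>\<theta> * ln (1 - exp (- (1 / x)))\<close>.\<close>

lemma inverted_max_stable_tail2:
  assumes inv: "inverted_max_stable_process M S Y' Y" and st: "s \<in> S" "t \<in> S"
    and fr: "frechet \<theta> (\<lambda>\<omega>. max (Y' s \<omega>) (Y' t \<omega>))" and x: "x > 0"
  shows "prob {\<omega> \<in> space M. x < Y s \<omega> \<and> x < Y t \<omega>} = (1 - exp (- (1 / x))) powr \<theta>"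
proof -
  have Y': "simple_max_stable_process M S Y'" using inv by (simp add: inverted_max_stable_process_def)
  note frs = simple_max_stable_frechet[OF Y']
  note [measurable] = inverted_max_stable_measurable[OF inv st(1)] inverted_max_stable_measurable[OF inv st(2)]
    frechet_measurable[OF frs[OF st(1)]] frechet_measurable[OF frs[OF st(2)]]
  let ?v = "- 1 / ln (1 - exp (- (1 / x)))"
  have L: "ln (1 - exp (- (1 / x))) < 0" using x by simp
  have v: "?v > 0" using L by (simp add: field_simps)
  \<comment> \<open>The equivalence is only almost sure, since the inversion is a decreasing
    involution on positive values of \<open>Y'\<close>.\<close>
  have "AE \<omega> in M. (x < Y s \<omega> \<and> x < Y t \<omega>) \<longleftrightarrow> max (Y' s \<omega>) (Y' t \<omega>) < ?v"
    using frechet_AE_pos[OF frs[OF st(1)] zero_less_one] frechet_AE_pos[OF frs[OF st(2)] zero_less_one] AE_space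
  proof eventually_elim
    case (elim \<omega>)
    then show ?case
      using inv st less_inverted_iff[of "Y' s \<omega>" x] less_inverted_iff[of "Y' t \<omega>" x] x
      by (simp add: inverted_max_stable_process_def)
  qed
  then have "prob {\<omega> \<in> space M. x < Y s \<omega> \<and> x < Y t \<omega>} = prob {\<omega> \<in> space M. max (Y' s \<omega>) (Y' t \<omega>) < ?v}"
    by (intro prob_eq_AE) auto
  also have "\<dots> = exp (- \<theta> / ?v)"
    by (rule frechet_prob_less[OF fr v])
  also have "\<dots> = (1 - exp (- (1 / x))) powr \<theta>"
    using x by (simp add: powr_def)
  finally show ?thesis .
qed

text \<open>The degenerate pair \<open>(s, s)\<close> has scale 1.\<close>

lemma inverted_max_stable_tail:
  assumes inv: "inverted_max_stable_process M S Y' Y" and s: "s \<in> S" and x: "x > 0"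
  shows "prob {\<omega> \<in> space M. x < Y s \<omega>} = 1 - exp (- (1 / x))"
proof -
  have "simple_max_stable_process M S Y'" using inv by (simp add: inverted_max_stable_process_def)
  from simple_max_stable_frechet[OF this s] show ?thesis
    using inverted_max_stable_tail2[OF inv s s, of 1 x] x by simp
qed

lemma inverted_max_stable_cdf2:
  assumes inv: "inverted_max_stable_process M S Y' Y" and st: "s \<in> S" "t \<in> S"
    and fr: "frechet \<theta> (\<lambda>\<omega>. max (Y' s \<omega>) (Y' t \<omega>))" and x: "x > 0"
  shows "prob {\<omega> \<in> space M. Y s \<omega> \<le> x \<and> Y t \<omega> \<le> x}
    = 2 * exp (- (1 / x)) - 1 + (1 - exp (- (1 / x))) powr \<theta>"
proof -
  note [measurable] = inverted_max_stable_measurable[OF inv st(1)] inverted_max_stable_measurable[OF inv st(2)]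
  let ?A = "{\<omega> \<in> space M. x < Y s \<omega>}" and ?B = "{\<omega> \<in> space M. x < Y t \<omega>}"
  have "prob (?A \<union> ?B) = prob ?A + prob ?B - prob (?A \<inter> ?B)"
    by (rule measure_Un3) (auto simp: fmeasurable_eq_sets)
  moreover have "?A \<inter> ?B = {\<omega> \<in> space M. x < Y s \<omega> \<and> x < Y t \<omega>}" by auto
  moreover have "{\<omega> \<in> space M. Y s \<omega> \<le> x \<and> Y t \<omega> \<le> x} = space M - (?A \<union> ?B)" by auto
  moreover have "prob (space M - (?A \<union> ?B)) = 1 - prob (?A \<union> ?B)"
    by (rule prob_compl) measurable
  ultimately show ?thesis
    using inverted_max_stable_tail[OF inv st(1) x] inverted_max_stable_tail[OF inv st(2) x]
      inverted_max_stable_tail2[OF inv st fr x] by simp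
qed

section \<open>The law of the max-mixture\<close>

text \<open>The event splits into one on the \<open>X\<close> pair at level \<open>z / a\<close> and
  one on the \<open>Y\<close> pair at level \<open>z / (1 - a)\<close>, which are independent. The
  weights 0 and 1 need separate treatment because of the divisions.\<close>

lemma max_mixture_cdf2:
  assumes X: "simple_max_stable_process M S X" and inv: "inverted_max_stable_process M S Y' Y"
    and ind: "independent_processes M S X Y" and st: "s \<in> S" "t \<in> S"
    and frX: "frechet \<theta> (\<lambda>\<omega>. max (X s \<omega>) (X t \<omega>))"
    and frY: "frechet \<rho> (\<lambda>\<omega>. max (Y' s \<omega>) (Y' t \<omega>))"
    and a: "0 \<le> a" "a \<le> 1" and z: "z > 0" and \<rho>: "\<rho> > 0"
  shows "prob {\<omega> \<in> space M. max (max_mixture a X Y s \<omega>) (max_mixture a X Y t \<omega>) \<le> z}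
    = exp (- a * \<theta> / z) * (2 * exp (- (1 - a) / z) - 1 + (1 - exp (- (1 - a) / z)) powr \<rho>)"
proof -
  let ?A = "{x. a * x \<le> z}" and ?B = "{y. (1 - a) * y \<le> z}"
  have [measurable]: "?A \<in> sets borel" "?B \<in> sets borel" by measurable
  have PX: "prob {\<omega> \<in> space M. X s \<omega> \<in> ?A \<and> X t \<omega> \<in> ?A} = exp (- a * \<theta> / z)"
  proof (cases "a = 0")
    case True
    then show ?thesis using z by (simp add: prob_space)
  next
    case False
    then have "{\<omega> \<in> space M. X s \<omega> \<in> ?A \<and> X t \<omega> \<in> ?A} = {\<omega> \<in> space M. max (X s \<omega>) (X t \<omega>) \<le> z / a}"
      using a by (auto simp: field_simps)
    then show ?thesis using frechet_prob_le[OF frX, of "z / a"] False a z by (simp add: mult.commute)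
  qed
  have PY: "prob {\<omega> \<in> space M. Y s \<omega> \<in> ?B \<and> Y t \<omega> \<in> ?B}
      = 2 * exp (- (1 - a) / z) - 1 + (1 - exp (- (1 - a) / z)) powr \<rho>"
  proof (cases "a = 1")
    \<comment> \<open>The condition on \<open>Y\<close> is void as \<open>z > 0\<close>, and the
      right-hand side is \<open>2 - 1 + 0 powr \<rho> = 1\<close>, using
      \<open>0 powr \<rho> = 0\<close>.\<close>
    case True
    then show ?thesis using z by (simp add: prob_space)
  next
    case False
    then have "{\<omega> \<in> space M. Y s \<omega> \<in> ?B \<and> Y t \<omega> \<in> ?B}
        = {\<omega> \<in> space M. Y s \<omega> \<le> z / (1 - a) \<and> Y t \<omega> \<le> z / (1 - a)}"
      using a by (auto simp: field_simps)
    moreover have "z / (1 - a) > 0" using z a False by simp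
    moreover have "- (1 / (z / (1 - a))) = - (1 - a) / z"
      using z by (simp add: field_simps)
    ultimately show ?thesis using inverted_max_stable_cdf2[OF inv st frY, of "z / (1 - a)"] by simp
  qed
  have "{\<omega> \<in> space M. max (max_mixture a X Y s \<omega>) (max_mixture a X Y t \<omega>) \<le> z}
      = {\<omega> \<in> space M. (X s \<omega> \<in> ?A \<and> X t \<omega> \<in> ?A) \<and> (Y s \<omega> \<in> ?B \<and> Y t \<omega> \<in> ?B)}"
    by (auto simp: max_mixture_def)
  then show ?thesis
    using independent_processes_prob2[OF ind st, of ?A ?B] PX PY by simp
qed

text \<open>For the pair \<open>(s, s)\<close> both scales are 1 and the second factor collapses to
  \<open>exp (- (1 - a) / z)\<close>, so that the exponents add up to
  \<open>- 1 / z\<close>.\<close>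

lemma max_mixture_frechet:
  assumes X: "simple_max_stable_process M S X" and inv: "inverted_max_stable_process M S Y' Y"
    and ind: "independent_processes M S X Y" and s: "s \<in> S" and a: "0 \<le> a" "a \<le> 1"
  shows "frechet 1 (max_mixture a X Y s)"
  unfolding frechet_def
proof safe
  note frX = simple_max_stable_frechet[OF X s]
  note [measurable] = frechet_measurable[OF frX] inverted_max_stable_measurable[OF inv s]
  show "max_mixture a X Y s \<in> borel_measurable M"
    unfolding max_mixture_def by measurable
  fix z :: real assume z: "z > 0"
  have "simple_max_stable_process M S Y'" using inv by (simp add: inverted_max_stable_process_def)
  note frY = simple_max_stable_frechet[OF this s]
  let ?e = "exp (- (1 - a) / z)"
  have e: "?e \<le> 1" using a z by (simp add: field_simps)
  have "prob {\<omega> \<in> space M. max_mixture a X Y s \<omega> \<le> z} =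
      exp (- a * 1 / z) * (2 * ?e - 1 + (1 - ?e) powr 1)"
    using max_mixture_cdf2[OF X inv ind s s, of 1 1 a z] frX frY a z
    unfolding max.idem by (simp only: zero_less_one)
  also have "\<dots> = exp (- a / z + - (1 - a) / z)"
    unfolding exp_add using e by simp
  also have "- a / z + - (1 - a) / z = - 1 / z"
    by (simp add: diff_divide_distrib)
  finally show "prob {\<omega> \<in> space M. max_mixture a X Y s \<omega> \<le> z} = exp (- 1 / z)" .
qed

text \<open>The site \<open>s\<close> shows that \<open>S\<close> is nonempty, which gives
  uniqueness in the \<open>THE\<close> of \<open>marginal_cdf\<close>.\<close>

lemma marginal_cdf_frechet:
  assumes "s \<in> S" and fr: "\<And>s. s \<in> S \<Longrightarrow> frechet 1 (Z s)"
  shows "marginal_cdf M S Z = frechet_cdf"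
proof -
  have "cdf (distr M borel (Z s)) = frechet_cdf" if "s \<in> S" for s
  proof
    fix x
    have [measurable]: "Z s \<in> borel_measurable M" using frechet_measurable[OF fr[OF that]] .
    have "cdf (distr M borel (Z s)) x = prob {\<omega> \<in> space M. Z s \<omega> \<le> x}"
      unfolding cdf_def by (subst measure_distr) (auto intro!: arg_cong[where f=prob])
    also have "\<dots> = frechet_cdf x"
      using frechet_prob_le[OF fr[OF that]] frechet_prob_nonpos[OF fr[OF that]]
      by (simp add: frechet_cdf_def)
    finally show "cdf (distr M borel (Z s)) x = frechet_cdf x" .
  qed
  then show ?thesis
    unfolding marginal_cdf_def using assms(1) by (intro the_equality) auto
qed

section \<open>Moments and the madogram\<close>

text \<open>On the open unit interval \<open>frechet_cdf (U \<omega>)\<close> has distribution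
  function \<open>t powr \<theta>\<close>. The result serves the margins with
  \<open>\<theta> = 1\<close>, and the pair maximum when \<open>a = 1\<close>.\<close>

lemma expectation_frechet_cdf_powr:
  assumes fr: "frechet \<theta> U" and l: "l > 0" and \<theta>: "\<theta> > 0"
  shows "expectation (\<lambda>\<omega>. frechet_cdf (U \<omega>) powr l) = \<theta> / (\<theta> + l)"
proof -
  note [measurable] = frechet_measurable[OF fr]
  have "expectation (\<lambda>\<omega>. frechet_cdf (U \<omega>) powr l) = 1 - l * (1 / (l + \<theta>))"
  proof (rule expectation_powr[where K="\<lambda>t. t powr \<theta>"])
    fix t :: real assume t: "0 < t" "t < 1"
    then have "- 1 / ln t > 0" by (simp add: field_simps)
    then show "prob {\<omega> \<in> space M. frechet_cdf (U \<omega>) \<le> t} = t powr \<theta>"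
      using t frechet_prob_le[OF fr, of "- 1 / ln t"]
      by (simp add: frechet_cdf_le_iff powr_def)
  next
    show "((\<lambda>t. t powr (l - 1) * t powr \<theta>) has_integral 1 / (l + \<theta>)) {0..1}"
      using has_integral_powr_from_0[of "l - 1 + \<theta>" 1] l \<theta> by (simp add: algebra_simps flip: powr_add)
  qed (use l in \<open>auto simp: frechet_cdf_range\<close>)
  also have "\<dots> = \<theta> / (\<theta> + l)" using l \<theta> by (simp add: field_simps)
  finally show ?thesis .
qed

lemma expectation_frechet_cdf_powr_mixture:
  fixes U :: "'a \<Rightarrow> real"
  assumes [measurable]: "U \<in> borel_measurable M"
    and cdf: "\<And>z. z > 0 \<Longrightarrow> prob {\<omega> \<in> space M. U \<omega> \<le> z}
      = exp (- a * \<theta> / z) * (2 * exp (- (1 - a) / z) - 1 + (1 - exp (- (1 - a) / z)) powr \<rho>)"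
    and a: "0 \<le> a" "a < 1" and l: "l > 0" and \<theta>: "\<theta> > 0" and \<rho>: "\<rho> > 0"
  shows "expectation (\<lambda>\<omega>. frechet_cdf (U \<omega>) powr l) =
    1 - 2 * l / (a * (\<theta> - 1) + 1 + l) + l / (a * \<theta> + l)
      - l * \<rho> / ((1 - a) * \<rho> + a * \<theta> + l) * Beta ((a * \<theta> + l) / (1 - a)) \<rho>"
proof -
  \<comment> \<open>The exponent \<open>r\<close> undoes the power \<open>1 - a\<close> in
    \<open>?W\<close>; \<open>c\<close> is the exponent of \<open>t\<close> that
    \<open>exp (- a * \<theta> / z)\<close> becomes once \<open>exp (- (1 - a) / z) = t\<close>;
    their sum \<open>p\<close> is the first argument of \<open>Beta\<close>.\<close>
  define r where "r = l / (1 - a)"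
  define c where "c = a * \<theta> / (1 - a)"
  define p where "p = (a * \<theta> + l) / (1 - a)"
  have p: "p = c + r" unfolding p_def c_def r_def by (simp add: add_divide_distrib)
  have r: "r > 0" and c: "c \<ge> 0" using a l \<theta> by (auto simp: r_def c_def)
  then have "p > 0" using p by simp
  \<comment> \<open>Raising to the power \<open>1 - a\<close> turns \<open>exp (- (1 - a) / z)\<close> into the integration variable, so
    that the moment integral is a Beta integral without substitution.\<close>
  let ?W = "\<lambda>\<omega>. frechet_cdf (U \<omega>) powr (1 - a)"
  have "expectation (\<lambda>\<omega>. ?W \<omega> powr r) = 1 - r * (2 / (p + 1) - 1 / p + \<rho> / (p + \<rho>) * Beta p \<rho>)"
  proof (rule expectation_powr[where K="\<lambda>t. t powr c * (2 * t - 1 + (1 - t) powr \<rho>)"])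
    fix t :: real assume t: "0 < t" "t < 1"
    \<comment> \<open>The level with \<open>u powr (1 - a) = t\<close>. Its quantile
      \<open>z = - 1 / ln u\<close> satisfies \<open>exp (- (1 - a) / z) = t\<close>.\<close>
    define u where "u = t powr (1 / (1 - a))"
    have lnu: "ln u = ln t / (1 - a)" using t by (simp add: u_def ln_powr)
    have "u > 0" using t by (simp add: u_def)
    moreover have "ln u < 0" using t a unfolding lnu by (intro divide_neg_pos) auto
    ultimately have u: "0 < u" "u < 1" by simp_all
    have z: "- 1 / ln u > 0" using u by (simp add: field_simps)
    have le: "frechet_cdf x powr (1 - a) \<le> t \<longleftrightarrow> frechet_cdf x \<le> u" for x
    proof -
      have "t = u powr (1 - a)" using t a by (simp add: u_def powr_powr)
      then show ?thesis
        using a u frechet_cdf_range(1)[of x] powr_mono2[of "1 - a" "frechet_cdf x" u]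
          powr_less_mono2[of "1 - a" u "frechet_cdf x"] by fastforce
    qed
    have "- a * \<theta> / (- 1 / ln u) = a * \<theta> * ln u" by simp
    also have "\<dots> = c * ln t" by (simp add: lnu c_def)
    finally have e1: "exp (- a * \<theta> / (- 1 / ln u)) = t powr c"
      using t by (simp add: powr_def)
    have e2: "exp (- (1 - a) / (- 1 / ln u)) = t"
      using t a by (simp add: lnu)
    show "prob {\<omega> \<in> space M. frechet_cdf (U \<omega>) powr (1 - a) \<le> t}
        = t powr c * (2 * t - 1 + (1 - t) powr \<rho>)"
      unfolding le frechet_cdf_le_iff[OF u] cdf[OF z] e1 e2 ..
  next
    show "((\<lambda>t. t powr (r - 1) * (t powr c * (2 * t - 1 + (1 - t) powr \<rho>))) has_integral
        2 / (p + 1) - 1 / p + \<rho> / (p + \<rho>) * Beta p \<rho>) {0..1}"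
    proof -
      have "t powr (r - 1) * (t powr c * w) = t powr (p - 1) * w" for t w
      proof -
        have "p - 1 = (r - 1) + c" by (simp add: p)
        then have "t powr (p - 1) = t powr (r - 1) * t powr c" by (simp only: powr_add)
        then show ?thesis by simp
      qed
      then show ?thesis using has_integral_powr_Beta[OF \<open>p > 0\<close> \<rho>] by (simp only:)
    qed
  next
    fix \<omega> show "0 \<le> ?W \<omega> \<and> ?W \<omega> \<le> 1"
      using a by (auto intro!: powr_le1 simp: frechet_cdf_range)
  qed (use r in auto)
  also have "\<dots> = 1 - r * (2 / (p + 1)) + r * (1 / p) - r * (\<rho> / (p + \<rho>)) * Beta p \<rho>"
    by (simp add: algebra_simps)
  also have "r * (2 / (p + 1)) = 2 * l / (a * (\<theta> - 1) + 1 + l)"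
  proof -
    have p1: "p + 1 = (a * (\<theta> - 1) + 1 + l) / (1 - a)" using a by (simp add: p_def field_simps)
    have cancel: "l / d * (2 / (w / d)) = 2 * l / w" if "d \<noteq> 0" for d w :: real
      using that by simp
    show ?thesis unfolding r_def p1 by (rule cancel) (use a in simp)
  qed
  also have "r * (1 / p) = l / (a * \<theta> + l)"
    using a by (simp add: r_def p_def)
  also have "r * (\<rho> / (p + \<rho>)) = l * \<rho> / ((1 - a) * \<rho> + a * \<theta> + l)"
  proof -
    have "p + \<rho> = ((1 - a) * \<rho> + a * \<theta> + l) / (1 - a)" using a by (simp add: p_def field_simps)
    then show ?thesis using a by (simp add: r_def)
  qed
  also have "(\<lambda>\<omega>. ?W \<omega> powr r) = (\<lambda>\<omega>. frechet_cdf (U \<omega>) powr l)"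
    using a by (simp add: powr_powr r_def)
  finally show ?thesis unfolding p_def .
qed

lemma madogram_frechet:
  assumes frs: "frechet 1 (Z s)" and frt: "frechet 1 (Z (s + h))" and l: "l > 0"
  shows "madogram M frechet_cdf l Z s h =
    expectation (\<lambda>\<omega>. frechet_cdf (max (Z s \<omega>) (Z (s + h) \<omega>)) powr l) - 1 / (1 + l)"
proof -
  note [measurable] = frechet_measurable[OF frs] frechet_measurable[OF frt]
  have int: "integrable M (\<lambda>\<omega>. frechet_cdf (f \<omega>) powr l)" if [measurable]: "f \<in> borel_measurable M" for f
    by (rule integrable_const_bound[where B=1])
      (use l in \<open>auto intro!: powr_le1 simp: frechet_cdf_range\<close>)
  have "\<bar>frechet_cdf x powr l - frechet_cdf y powr l\<bar>
      = 2 * frechet_cdf (max x y) powr l - (frechet_cdf x powr l + frechet_cdf y powr l)" for x y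
  proof -
    have mono: "frechet_cdf u powr l \<le> frechet_cdf v powr l" if "u \<le> v" for u v
      using l monoD[OF frechet_cdf_mono that] by (intro powr_mono2) (auto simp: frechet_cdf_range)
    show ?thesis using mono[of x y] mono[of y x] by (auto simp: max_def)
  qed
  then have "madogram M frechet_cdf l Z s h = 1 / 2 * (LINT \<omega>|M. 2 * frechet_cdf (max (Z s \<omega>) (Z (s + h) \<omega>)) powr l
      - (frechet_cdf (Z s \<omega>) powr l + frechet_cdf (Z (s + h) \<omega>) powr l))"
    unfolding madogram_def by simp
  also have "\<dots> = expectation (\<lambda>\<omega>. frechet_cdf (max (Z s \<omega>) (Z (s + h) \<omega>)) powr l)
      - (expectation (\<lambda>\<omega>. frechet_cdf (Z s \<omega>) powr l) + expectation (\<lambda>\<omega>. frechet_cdf (Z (s + h) \<omega>) powr l)) / 2"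
    by (subst Bochner_Integration.integral_diff) (auto simp: int add_divide_distrib)
  finally show ?thesis
    using expectation_frechet_cdf_powr[OF frs l] expectation_frechet_cdf_powr[OF frt l] by (simp add: field_simps)
qed

section \<open>Tail dependence and extremal coefficient of the inverted process\<close>

text \<open>The joint tail is known exactly for \<open>x > 0\<close> and is asymptotic to
  \<open>x powr - \<theta>\<close>, so the constant 1 serves as slowly varying factor.\<close>

lemma inverted_max_stable_tail_dependence:
  assumes inv: "inverted_max_stable_process M S Y' Y" and st: "s \<in> S" "t \<in> S"
    and fr: "frechet \<theta> (\<lambda>\<omega>. max (Y' s \<omega>) (Y' t \<omega>))" and \<theta>: "\<theta> > 0"
  shows "has_tail_dependence_coefficient M (Y s) (Y t) (1 / \<theta>)"
  unfolding has_tail_dependence_coefficient_def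
proof (intro conjI exI[of _ "\<lambda>_. 1"])
  show "slowly_varying (\<lambda>_. 1)" by (simp add: slowly_varying_def)
  have "\<forall>\<^sub>F x in at_top. (1 - exp (- (1 / x))) powr \<theta> =
      prob {\<omega> \<in> space M. x < Y s \<omega> \<and> x < Y t \<omega>}"
    using eventually_gt_at_top[of 0]
    by eventually_elim (rule inverted_max_stable_tail2[OF inv st fr, symmetric])
  from asymp_equiv_transfer[OF one_minus_exp_inverse_asymp_equiv this]
  show "(\<lambda>x. prob {\<omega> \<in> space M. x < Y s \<omega> \<and> x < Y t \<omega>})
      \<sim>[at_top] (\<lambda>x. x powr (- 1 / (1 / \<theta>)) * 1)" by simp
qed (use \<theta> in simp)

text \<open>Stationarity is assumed of \<open>Y\<close>, whereas the coefficient is defined through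
  \<open>Y'\<close>. Translation invariance at level 1 is carried back through the joint tail of
  \<open>Y\<close>.\<close>

lemma inverted_extremal_coefficient_frechet:
  fixes Y Y' :: "'b::euclidean_space \<Rightarrow> 'a \<Rightarrow> real"
  assumes inv: "inverted_max_stable_process M S Y' Y" and stat: "stationary M S Y"
    and s: "s \<in> S" "s + h \<in> S"
  shows "extremal_coefficient M S Y' h \<ge> 1"
    "frechet (extremal_coefficient M S Y' h) (\<lambda>\<omega>. max (Y' s \<omega>) (Y' (s + h) \<omega>))"
proof -
  have Y': "simple_max_stable_process M S Y'" using inv by (simp add: inverted_max_stable_process_def)
  \<comment> \<open>\<open>y\<close> corresponds to the level \<open>1\<close> of \<open>Y'\<close>, as the inversion is a decreasing involution.\<close>
  define y :: real where "y = - 1 / ln (1 - exp (- (1 / 1)))"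
  have y: "y > 0" unfolding y_def by (simp add: field_simps)
  have key: "prob {\<omega> \<in> space M. Y' t \<omega> \<le> 1 \<and> Y' (t + h) \<omega> \<le> 1}
      = prob {\<omega> \<in> space M. y < Y t \<omega> \<and> y < Y (t + h) \<omega>}"
    if t: "t \<in> S" "t + h \<in> S" for t
  proof -
    \<comment> \<open>This scale may depend on \<open>t\<close>; both probabilities equal
      \<open>exp (- \<theta>)\<close> for the same \<open>\<theta>\<close>.\<close>
    obtain \<theta> where fr: "frechet \<theta> (\<lambda>\<omega>. max (Y' t \<omega>) (Y' (t + h) \<omega>))"
      using simple_max_stable_pair_frechet[OF Y' t] by blast
    have "1 - exp (- (1 / y)) = exp (- 1)"
      by (simp add: y_def)
    then have "(1 - exp (- (1 / y))) powr \<theta> = exp (- \<theta>)"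
      by (simp add: powr_def)
    then show ?thesis
      using inverted_max_stable_tail2[OF inv t fr y] frechet_prob_le[OF fr, of 1] by simp
  qed
  have inv': "prob {\<omega> \<in> space M. Y' t \<omega> \<le> 1 \<and> Y' (t + h) \<omega> \<le> 1}
      = prob {\<omega> \<in> space M. Y' s \<omega> \<le> 1 \<and> Y' (s + h) \<omega> \<le> 1}"
    if t: "t \<in> S" "t + h \<in> S" for t
    unfolding key[OF t] key[OF s]
    using stationary_prob2[OF inverted_max_stable_measurable[OF inv] stat s t, of "{y<..}" "{y<..}"]
    by simp
  show "extremal_coefficient M S Y' h \<ge> 1"
    "frechet (extremal_coefficient M S Y' h) (\<lambda>\<omega>. max (Y' s \<omega>) (Y' (s + h) \<omega>))"
    using extremal_coefficient_frechet[OF Y' s inv'] by blast+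
qed

end

section \<open>The madogram formula for the max-mixture\<close>

text \<open>The limit in the second conjunct certifies that the value 0 taken by the beta term at
  \<open>a = 1\<close> is its limit from the left.\<close>

theorem proposition3p1:
  fixes M :: "'w measure"
    and S :: "'a::euclidean_space set"
    and X Y Y' Z :: "'a \<Rightarrow> 'w \<Rightarrow> real"
    and \<theta>X \<theta>Y :: "'a \<Rightarrow> real"
    and F :: "real \<Rightarrow> real"
    and a l :: real
    and s h :: 'a
  assumes "prob_space M"
    and "simple_max_stable_process M S X"
    and "inverted_max_stable_process M S Y' Y"
    and "independent_processes M S X Y"
    and "stationary M S X" and "isotropic M S X"
    and "stationary M S Y" and "isotropic M S Y"
    and "\<theta>X = extremal_coefficient M S X"
    and "\<theta>Y = extremal_coefficient M S Y'"
    and "0 \<le> a" and "a \<le> 1"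
    and "Z = max_mixture a X Y"
    and "F = marginal_cdf M S Z"
    and "l > 0"
    and "s \<in> S" and "s + h \<in> S"
  shows "has_tail_dependence_coefficient M (Y s) (Y (s + h)) (1 / \<theta>Y h) \<and>
    ((\<lambda>b. l * \<theta>Y h / ((1 - b) * \<theta>Y h + b * \<theta>X h + l)
           * Beta ((b * \<theta>X h + l) / (1 - b)) (\<theta>Y h)) \<longlongrightarrow> 0) (at_left 1) \<and>
    madogram M F l Z s h =
      l / (1 + l) - 2 * l / (a * (\<theta>X h - 1) + 1 + l) + l / (a * \<theta>X h + l)
      - (if a = 1 then 0
         else l * \<theta>Y h / ((1 - a) * \<theta>Y h + a * \<theta>X h + l)
              * Beta ((a * \<theta>X h + l) / (1 - a)) (\<theta>Y h))"
proof -
  interpret prob_space M by fact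
  note X = assms(2) and inv = assms(3) and ind = assms(4) and a = assms(11,12) and l = assms(15)
    and s = assms(16,17)
  have meas: "X t \<in> borel_measurable M" if "t \<in> S" for t
    using frechet_measurable[OF simple_max_stable_frechet[OF X that]] .
  have invX: "prob {\<omega> \<in> space M. X t \<omega> \<le> 1 \<and> X (t + h) \<omega> \<le> 1}
      = prob {\<omega> \<in> space M. X s \<omega> \<le> 1 \<and> X (s + h) \<omega> \<le> 1}"
    if t: "t \<in> S" "t + h \<in> S" for t
    using stationary_prob2[OF meas assms(5) s t, of "{..1}" "{..1}"] by simp
  have \<theta>X: "\<theta>X h \<ge> 1" and frX: "frechet (\<theta>X h) (\<lambda>\<omega>. max (X s \<omega>) (X (s + h) \<omega>))"
    unfolding assms(9) using extremal_coefficient_frechet[OF X s invX] by blast+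
  have \<theta>Y: "\<theta>Y h \<ge> 1" and frY: "frechet (\<theta>Y h) (\<lambda>\<omega>. max (Y' s \<omega>) (Y' (s + h) \<omega>))"
    unfolding assms(10) using inverted_extremal_coefficient_frechet[OF inv assms(7) s] by blast+
  have pos: "\<theta>X h > 0" "\<theta>Y h > 0" using \<theta>X \<theta>Y by auto
  have frZ: "frechet 1 (Z t)" if "t \<in> S" for t
    unfolding assms(13) by (rule max_mixture_frechet[OF X inv ind that a])
  have F: "F = frechet_cdf"
    unfolding assms(14) by (rule marginal_cdf_frechet[OF s(1) frZ])
  let ?U = "\<lambda>\<omega>. max (Z s \<omega>) (Z (s + h) \<omega>)"
  have cdf: "prob {\<omega> \<in> space M. ?U \<omega> \<le> z} = exp (- a * \<theta>X h / z) *
      (2 * exp (- (1 - a) / z) - 1 + (1 - exp (- (1 - a) / z)) powr \<theta>Y h)" if "z > 0" for z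
    unfolding assms(13) by (rule max_mixture_cdf2[OF X inv ind s frX frY a that pos(2)])
  note [measurable] = frechet_measurable[OF frZ[OF s(1)]] frechet_measurable[OF frZ[OF s(2)]]
  have U: "?U \<in> borel_measurable M" by measurable
  have "expectation (\<lambda>\<omega>. frechet_cdf (?U \<omega>) powr l) =
      1 - 2 * l / (a * (\<theta>X h - 1) + 1 + l) + l / (a * \<theta>X h + l)
      - (if a = 1 then 0
         else l * \<theta>Y h / ((1 - a) * \<theta>Y h + a * \<theta>X h + l)
              * Beta ((a * \<theta>X h + l) / (1 - a)) (\<theta>Y h))"
  proof (cases "a = 1")
    \<comment> \<open>Here the pair maximum is Frechet with scale \<open>\<theta>X h\<close>, and
      the two fractions with denominator \<open>\<theta>X h + l\<close> combine into
      \<open>- l / (\<theta>X h + l)\<close>.\<close>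
    case True
    have "frechet (\<theta>X h) ?U"
      unfolding frechet_def using U cdf pos True by simp
    then have "expectation (\<lambda>\<omega>. frechet_cdf (?U \<omega>) powr l) = \<theta>X h / (\<theta>X h + l)"
      by (rule expectation_frechet_cdf_powr[OF _ l pos(1)])
    also have "\<dots> = 1 - l / (\<theta>X h + l)"
      using l pos(1) by (simp add: field_simps)
    finally show ?thesis using True by simp
  next
    case False
    then show ?thesis
      using expectation_frechet_cdf_powr_mixture[OF U cdf a(1) _ l pos] a by simp
  qed
  then have "madogram M F l Z s h =
      l / (1 + l) - 2 * l / (a * (\<theta>X h - 1) + 1 + l) + l / (a * \<theta>X h + l)
      - (if a = 1 then 0
         else l * \<theta>Y h / ((1 - a) * \<theta>Y h + a * \<theta>X h + l)
              * Beta ((a * \<theta>X h + l) / (1 - a)) (\<theta>Y h))"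
  proof -
    have "1 - 1 / (1 + l) = l / (1 + l)" using l by (simp add: field_simps)
    then show ?thesis
      unfolding F madogram_frechet[OF frZ[OF s(1)] frZ[OF s(2)] l]
      using \<open>expectation (\<lambda>\<omega>. frechet_cdf (?U \<omega>) powr l) = _\<close> by linarith
  qed
  then show ?thesis
    using inverted_max_stable_tail_dependence[OF inv s frY pos(2)]
      Beta_divide_tendsto_0[of "\<theta>X h" "\<theta>Y h" l] pos(1) \<theta>Y l by simp
qed

end
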